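(* Let $b,\rho\in\mathbb{C}$ with $\operatorname{Re}(\rho)>0$ and let $z\in\mathbb{C}\setminus(-\infty,0]$. (i) If $\nu,c\in\mathbb{C}$ with $\operatorname{Re}(\nu)>-\tfrac32$ and $\operatorname{Re}(c)>\tfrac12$, then $$g_\nu^{(b,c)}(z;\rho)=\frac{\sqrt\pi\,(z/2)^\nu}{2[\Gamma(\nu+\frac32)]^2\,\Gamma(c-\frac12)}\int_0^\infty t^{c+\nu-1}e^{-t-\frac\rho t}\;{}_0F_3\Big(-;\tfrac{2\nu+3}2,\tfrac{2\nu+3}4,\tfrac{2\nu+5}4;\tfrac{-bz^2t^2}{16}\Big)\,dt .$$ (ii) If $\nu,\lambda\in\mathbb{C}$ with $\operatorname{Re}(\nu)>-1$ and $\operatorname{Re}(\lambda)>0$, then $$C_\nu^{(b,\lambda)}(z;\rho)=\frac{1}{[\Gamma(\nu+1)]^2\,\Gamma(\lambda)}\int_0^\infty t^{\lambda+\nu-1}e^{-t-\frac\rho t}\;{}_0F_3\Big(-;\nu+1,\tfrac{\nu+1}2,\tfrac{\nu+2}2;\tfrac{-bzt^2}{4}\Big)\,dt .$$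
   Context: For $\rho\in\mathbb{C}$ with $\operatorname{Re}(\rho)>0$ and $x\in\mathbb{C}$ put $\Gamma_\rho(x)=\int_0^\infty t^{x-1}e^{-t-\rho/t}\,dt$. The generalized Pochhammer symbol is $(\lambda;\rho)_\nu:=\Gamma_\rho(\lambda+\nu)/\Gamma(\lambda)$. The unified four parameter Bessel function is $G_\nu^{(b,c)}(z;\rho):=\sum_{k=0}^\infty \frac{(-b)^k (c;\rho)_{2k+\nu}}{\Gamma(\nu+k+1)\,\Gamma(\nu+2k+1)}\,\frac{(z/2)^{2k+\nu}}{k!}$. The generalized four parameter spherical Bessel and Bessel-Clifford functions are $$g_\nu^{(b,c)}(z;\rho):=\sqrt{\tfrac{\pi}{2z}}\,G_{\nu+\frac12}^{(b,c-\frac12)}(z;\rho)=\frac{\sqrt\pi}{2}\sum_{k=0}^\infty\frac{(-b)^k(c-\frac12;\rho)_{2k+\nu+\frac12}}{k!\,\Gamma(\nu+k+\frac32)\,\Gamma(\nu+2k+\frac32)}\Big(\frac z2\Big)^{2k+\nu},$$ $$C_\nu^{(b,\lambda)}(z;\rho):=z^{-\nu/2}G_\nu^{(b,\lambda)}(2\sqrt z;\rho)=\sum_{k=0}^\infty\frac{(-b)^k(\lambda;\rho)_{2k+\nu}}{k!\,\Gamma(\nu+k+1)\,\Gamma(\nu+2k+1)}\,z^k.$$ Powers and square roots are principal. Also ${}_0F_3(-;a_1,a_2,a_3;x)=\sum_{k=0}^\infty \frac{1}{(a_1)_k(a_2)_k(a_3)_k}\frac{x^k}{k!}$ with $(a)_k=\Gamma(a+k)/\Gamma(a)$.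 *)

theory Defs
  imports "HOL-Analysis.Analysis"
begin

definition gen_Gamma :: "complex \<Rightarrow> complex \<Rightarrow> complex" where
  "gen_Gamma \<rho> x =
     (LBINT t:{0<..}. complex_of_real t powr (x - 1) * exp (- complex_of_real t - \<rho> / complex_of_real t))"

definition gen_pochhammer :: "complex \<Rightarrow> complex \<Rightarrow> complex \<Rightarrow> complex" where
  "gen_pochhammer l \<rho> \<nu> = gen_Gamma \<rho> (l + \<nu>) / Gamma l"

text \<open>
  In the library \<open>Gamma\<close> is \<open>0\<close> at its poles and \<open>x / 0 = 0\<close>, so the quotients by \<open>Gamma\<close> below
  agree with the entire function \<open>1 / Gamma\<close> everywhere. Since \<open>0 powr w = 0\<close> also for \<open>w = 0\<close>,
  the series has its usual meaning for \<open>z \<noteq> 0\<close> only.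
\<close>

definition gen_Bessel :: "complex \<Rightarrow> complex \<Rightarrow> complex \<Rightarrow> complex \<Rightarrow> complex \<Rightarrow> complex" where
  "gen_Bessel b c \<nu> z \<rho> =
     (\<Sum>k. (- b) ^ k * gen_pochhammer c \<rho> (2 * of_nat k + \<nu>)
            / (Gamma (\<nu> + of_nat k + 1) * Gamma (\<nu> + 2 * of_nat k + 1))
            * ((z / 2) powr (2 * of_nat k + \<nu>) / fact k))"

definition gen_spherical_Bessel :: "complex \<Rightarrow> complex \<Rightarrow> complex \<Rightarrow> complex \<Rightarrow> complex \<Rightarrow> complex" where
  "gen_spherical_Bessel b c \<nu> z \<rho> =
     csqrt (of_real pi / (2 * z)) * gen_Bessel b (c - 1/2) (\<nu> + 1/2) z \<rho>"

definition gen_Bessel_Clifford :: "complex \<Rightarrow> complex \<Rightarrow> complex \<Rightarrow> complex \<Rightarrow> complex \<Rightarrow> complex" where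
  "gen_Bessel_Clifford b l \<nu> z \<rho> = z powr (- \<nu> / 2) * gen_Bessel b l \<nu> (2 * csqrt z) \<rho>"

definition hyp0F3 :: "complex \<Rightarrow> complex \<Rightarrow> complex \<Rightarrow> complex \<Rightarrow> complex" where
  "hyp0F3 a1 a2 a3 x =
     (\<Sum>k. 1 / (pochhammer a1 k * pochhammer a2 k * pochhammer a3 k) * (x ^ k / fact k))"

end

theory Submission
  imports Defs "HOL-Real_Asymp.Real_Asymp"
begin

text \<open>
  Both formulas are instances of one integral representation of the Bessel function
  \<open>G\<close> itself, gen_Bessel_integral_representation. Since
  \<open>(c; \<rho>)\<^bsub>2k+\<nu>\<^esub> = \<Gamma>\<^sub>\<rho>(c + \<nu> + 2k) / \<Gamma>(c)\<close> is, up to a constant, the Mellin type integral of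
  \<open>t\<^bsup>2k\<^esup>\<close> against the weight \<open>t\<^bsup>c+\<nu>-1\<^esup> exp (- t - \<rho> / t)\<close>, the series for \<open>G\<close> is the termwise
  integral of a power series in \<open>t\<^sup>2\<close>. With \<open>a = \<nu> + 1\<close> the remaining Gamma factors contribute
  \<open>1 / (\<Gamma>(a)\<^sup>2 (a)\<^sub>k (a)\<^bsub>2k\<^esub>)\<close>, and the duplication formula
  \<open>(a)\<^bsub>2k\<^esub> = 4\<^sup>k (a/2)\<^sub>k ((a+1)/2)\<^sub>k\<close> identifies that power series as \<open>0F3\<close> with parameters
  \<open>a, a/2, (a+1)/2\<close>.

  The analytic point is the exchange of sum and integral (hyp0F3_gen_Gamma_transform), for which
  the integrals of the absolute values of the terms must be summable. The real part of \<open>c + \<nu>\<close> may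
  be negative, but \<open>exp (- Re \<rho> / t)\<close> vanishes at \<open>0\<close> faster than every power of \<open>t\<close>, so it can be
  traded for a factor \<open>C t\<^sup>n\<close>; this bounds the integral of the \<open>k\<close>-th weight by an ordinary
  \<open>C \<Gamma>(P + 2k)\<close> with \<open>P > 0\<close>. These grow by a factor of order \<open>4k\<^sup>2\<close> from one \<open>k\<close> to the
  next, while the coefficients shrink by a factor of order \<open>4k\<^sup>4\<close>, so the ratio test applies
  (summable_bessel_coeff_weighted).

  The spherical and Clifford functions then only require the algebra of principal branches. For
  the spherical prefactor \<open>z\<close> must avoid the negative real axis, where \<open>csqrt (1 / z)\<close> and
  \<open>1 / csqrt z\<close> differ by a sign.
\<close>

section \<open>The weight of the generalized Gamma function\<close>

text \<open>
  The constants come from \<open>exp (- y) \<le> 1 / y\<close> at \<open>y = r / (n t)\<close>, raised to the power \<open>n\<close>. The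
  parameter \<open>u\<close> is quantified after \<open>C\<close> and \<open>P\<close> so that one pair of constants serves all terms of
  the series.
\<close>

lemma powr_exp_weight_dominated:
  fixes r s :: real
  assumes r: "r > 0"
  obtains C P where "C \<ge> 0" "P > 0"
    "\<And>t u. t > 0 \<Longrightarrow> t powr (s + u - 1) * exp (- t - r / t) \<le> C * (t powr (P + u - 1) / exp t)"
proof -
  obtain n :: nat where n: "real n > max 1 (- s)"
    using reals_Archimedean2 by blast
  show ?thesis
  proof
    show "(real n / r) ^ n \<ge> 0"
      using r by simp
    show "s + real n > 0"
      using n by simp
    fix t u :: real
    assume t: "t > 0"
    define y where "y = r / (real n * t)"
    have y: "y > 0"
      using r t n by (simp add: y_def)
    have "y \<le> exp y"
      using exp_ge_add_one_self[of y] by linarith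
    then have "exp (- y) \<le> 1 / y"
      using y by (simp add: exp_minus field_simps)
    then have "exp (- y) ^ n \<le> (1 / y) ^ n"
      by (intro power_mono) auto
    moreover have "exp (- y) ^ n = exp (- (r / t))"
      using n t by (simp add: y_def exp_of_nat_mult[symmetric])
    moreover have "(1 / y) ^ n = (real n / r) ^ n * t powr real n"
      using t by (simp add: y_def powr_realpow power_mult_distrib power_divide)
    ultimately have "exp (- (r / t)) \<le> (real n / r) ^ n * t powr real n"
      by simp
    then have "t powr (s + u - 1) * exp (- t) * exp (- (r / t))
        \<le> t powr (s + u - 1) * exp (- t) * ((real n / r) ^ n * t powr real n)"
      by (intro mult_left_mono) auto
    also have "\<dots> = (real n / r) ^ n * (t powr (s + real n + u - 1) / exp t)"
      using t by (simp add: powr_add powr_diff exp_minus field_simps)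
    finally show "t powr (s + u - 1) * exp (- t - r / t)
        \<le> (real n / r) ^ n * (t powr (s + real n + u - 1) / exp t)"
      by (simp add: exp_diff exp_minus field_simps)
  qed
qed

lemma Gamma_lborel_integral:
  fixes x :: real
  assumes "x > 0"
  shows "set_integrable lborel {0<..} (\<lambda>t. t powr (x - 1) / exp t)"
    and "(LBINT t:{0<..}. t powr (x - 1) / exp t) = Gamma x"
proof -
  let ?f = "\<lambda>t::real. t powr (x - 1) / exp t"
  have "(?f has_integral Gamma x) {0<..}"
    using Gamma_integral_real[OF assms]
    by (rule has_integral_spike_set_eq[THEN iffD1, rotated 2])
       (auto intro: negligible_subset[of "{0}"])
  then have "?f absolutely_integrable_on {0<..}"
    by (subst absolutely_integrable_on_iff_nonneg) auto
  then show si: "set_integrable lborel {0<..} ?f"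
    unfolding set_integrable_def by (subst (asm) integrable_completion) auto
  show "(LBINT t:{0<..}. ?f t) = Gamma x"
    using set_borel_integral_eq_integral(2)[OF si] \<open>(?f has_integral Gamma x) {0<..}\<close>
    by (simp add: integral_unique)
qed

lemma norm_gen_Gamma_integrand:
  fixes t :: real
  assumes "t > 0"
  shows "norm (complex_of_real t powr (x - 1) * exp (- complex_of_real t - \<rho> / complex_of_real t))
    = t powr (Re x - 1) * exp (- t - Re \<rho> / t)"
  using assms by (simp add: norm_mult norm_powr_real_powr)

lemma gen_Gamma_integrand_bound:
  fixes \<rho> s :: complex
  assumes "Re \<rho> > 0"
  obtains C P :: real where "C \<ge> 0" "P > 0"
    "\<And>k::nat. set_integrable lborel {0<..}
       (\<lambda>t. complex_of_real t powr (s + 2 * of_nat k - 1)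
             * exp (- complex_of_real t - \<rho> / complex_of_real t))"
    "\<And>k::nat. (LBINT t:{0<..}. norm (complex_of_real t powr (s + 2 * of_nat k - 1)
             * exp (- complex_of_real t - \<rho> / complex_of_real t))) \<le> C * Gamma (P + 2 * real k)"
proof -
  obtain C P where CP: "C \<ge> 0" "P > 0"
    "\<And>t u. t > 0 \<Longrightarrow> t powr (Re s + u - 1) * exp (- t - Re \<rho> / t) \<le> C * (t powr (P + u - 1) / exp t)"
    using powr_exp_weight_dominated[OF assms] by metis
  let ?h = "\<lambda>(k::nat) t. complex_of_real t powr (s + 2 * of_nat k - 1)
             * exp (- complex_of_real t - \<rho> / complex_of_real t)"
  have le: "norm (?h k t) \<le> C * (t powr (P + 2 * real k - 1) / exp t)" if "t > 0" for k t
    using norm_gen_Gamma_integrand[OF that, of "s + 2 * of_nat k" \<rho>] CP(3)[OF that, of "2 * real k"]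
    by simp
  have dom: "set_integrable lborel {0<..} (\<lambda>t. C * (t powr (P + 2 * real k - 1) / exp t))" for k
    using CP(2) by (intro set_integrable_mult_right Gamma_lborel_integral) auto
  have int: "set_integrable lborel {0<..} (?h k)" for k
  proof (rule set_integrable_bound[OF dom])
    show "set_borel_measurable lborel {0<..} (?h k)"
      unfolding set_borel_measurable_def measurable_lborel2
      by (intro borel_measurable_continuous_on_indicator continuous_intros) auto
    show "AE t in lborel. t \<in> {0<..} \<longrightarrow> norm (?h k t) \<le> norm (C * (t powr (P + 2 * real k - 1) / exp t))"
      using le CP(1) by (intro AE_I2) (simp add: abs_mult)
  qed
  have "(LBINT t:{0<..}. norm (?h k t)) \<le> C * Gamma (P + 2 * real k)" for k
  proof -
    have "(LBINT t:{0<..}. norm (?h k t)) \<le> (LBINT t:{0<..}. C * (t powr (P + 2 * real k - 1) / exp t))"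
      by (intro set_integral_mono set_integrable_norm int dom le) auto
    also have "\<dots> = C * Gamma (P + 2 * real k)"
      using CP(2) by (subst set_integral_mult_right, subst Gamma_lborel_integral(2)) auto
    finally show ?thesis .
  qed
  then show ?thesis
    using that[OF CP(1,2) int] by blast
qed


section \<open>The hypergeometric coefficients\<close>

text \<open>
  The coefficient of \<open>t\<^bsup>2k\<^esup>\<close> in the \<open>0F3\<close> kernel, with the two half-step Pochhammer symbols merged
  into a single one of length \<open>2k\<close>, the form in which it arises from \<open>1 / \<Gamma>(\<nu> + 2k + 1)\<close>.
\<close>

definition bessel_coeff :: "complex \<Rightarrow> complex \<Rightarrow> nat \<Rightarrow> complex" where
  "bessel_coeff a B k = B ^ k / (pochhammer a k * pochhammer a (2 * k) * fact k)"

lemma hyp0F3_duplication: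
  "hyp0F3 a (a / 2) ((a + 1) / 2) (B * x\<^sup>2 / 4) = (\<Sum>k. bessel_coeff a B k * x ^ (2 * k))"
proof -
  have "1 / (pochhammer a k * pochhammer (a / 2) k * pochhammer ((a + 1) / 2) k) * ((B * x\<^sup>2 / 4) ^ k / fact k)
      = bessel_coeff a B k * x ^ (2 * k)" for k
  proof -
    have "pochhammer a (2 * k) = 4 ^ k * (pochhammer (a / 2) k * pochhammer ((a + 1) / 2) k)"
      using pochhammer_double[of "a / 2" k] by (simp add: power_mult add_divide_distrib)
    then show ?thesis
      by (simp add: bessel_coeff_def power_mult_distrib power_divide power_mult)
  qed
  then show ?thesis
    by (simp add: hyp0F3_def)
qed

lemma bessel_coeff_Suc:
  "bessel_coeff a B (Suc k) =
     bessel_coeff a B k * (B / ((a + of_nat k) * (a + 2 * of_nat k) * (a + 2 * of_nat k + 1) * of_nat (Suc k)))"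
  by (simp add: bessel_coeff_def pochhammer_Suc algebra_simps)

text \<open>
  The ratio of consecutive coefficients has order \<open>k\<^bsup>-4\<^esup>\<close> and therefore beats any weight whose ratios
  grow at most quadratically. Two such weights are needed: \<open>t\<^bsup>2k\<^esup>\<close> for the pointwise convergence of
  the integrand, and \<open>\<Gamma>(P + 2k)\<close> for the convergence of the integrals.
\<close>

lemma summable_bessel_coeff_weighted:
  fixes w :: "nat \<Rightarrow> real"
  assumes a: "Re a > 0" and K: "K \<ge> 0" and P: "P \<ge> 0"
    and w0: "\<And>k. w k \<ge> 0"
    and w: "\<And>k. w (Suc k) \<le> K * ((P + 2 * real k) * (P + 2 * real k + 1)) * w k"
  shows "summable (\<lambda>k. norm (bessel_coeff a B k) * w k)"
proof -
  let ?q = "\<lambda>k::nat. norm B * K * ((P + 2 * real k) * (P + 2 * real k + 1))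
      / (real k * (2 * real k) * (2 * real k + 1) * real (Suc k))"
  have "?q \<longlonglongrightarrow> 0"
    by real_asymp
  then have "eventually (\<lambda>k. ?q k < 1 / 2) sequentially"
    by (rule order_tendstoD) auto
  then obtain N where N: "\<And>k. k \<ge> N \<Longrightarrow> ?q k < 1 / 2"
    by (auto simp: eventually_sequentially)
  show ?thesis
  proof (rule summable_ratio_test[of "1 / 2" "max N 1"])
    fix k assume k: "k \<ge> max N 1"
    let ?d = "(a + of_nat k) * (a + 2 * of_nat k) * (a + 2 * of_nat k + 1) * of_nat (Suc k)"
    let ?e = "real k * (2 * real k) * (2 * real k + 1) * real (Suc k)"
    have "norm (a + of_nat k) \<ge> real k" "norm (a + 2 * of_nat k) \<ge> 2 * real k"
      "norm (a + 2 * of_nat k + 1) \<ge> 2 * real k + 1"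
      using a complex_Re_le_cmod[of "a + of_nat k"] complex_Re_le_cmod[of "a + 2 * of_nat k"]
        complex_Re_le_cmod[of "a + 2 * of_nat k + 1"] by auto
    then have "?e \<le> norm ?d"
      unfolding norm_mult norm_of_nat by (intro mult_mono mult_nonneg_nonneg) auto
    moreover have "?e > 0"
      using k by simp
    ultimately have quot: "norm (B / ?d) \<le> norm B / ?e"
      unfolding norm_divide by (rule frac_le[OF norm_ge_zero order_refl, rotated])
    have "norm (bessel_coeff a B (Suc k)) * w (Suc k)
        \<le> (norm (bessel_coeff a B k) * (norm B / ?e)) * (K * ((P + 2 * real k) * (P + 2 * real k + 1)) * w k)"
      unfolding bessel_coeff_Suc norm_mult[of "bessel_coeff a B k"]
      using w0 w quot by (intro mult_mono mult_left_mono) auto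
    also have "\<dots> = ?q k * (norm (bessel_coeff a B k) * w k)"
      by simp
    also have "\<dots> \<le> 1 / 2 * (norm (bessel_coeff a B k) * w k)"
      using N[of k] k w0[of k] by (intro mult_right_mono) auto
    finally show "norm (norm (bessel_coeff a B (Suc k)) * w (Suc k))
        \<le> 1 / 2 * norm (norm (bessel_coeff a B k) * w k)"
      using w0 by simp
  qed auto
qed


section \<open>Termwise integration\<close>

text \<open>
  Integrating the \<open>0F3\<close> series term by term against the weight of \<open>\<Gamma>\<^sub>\<rho>\<close> replaces each power
  \<open>t\<^bsup>2k\<^esup>\<close> by \<open>\<Gamma>\<^sub>\<rho>(s + 2k)\<close>. The exchange is legitimate for every complex \<open>s\<close>, because the
  weight decays rapidly at both ends of the half-line.
\<close>

lemma hyp0F3_gen_Gamma_transform: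
  fixes \<rho> a s B :: complex
  assumes rho: "Re \<rho> > 0" and a: "Re a > 0"
  defines "f \<equiv> \<lambda>t::real. complex_of_real t powr (s - 1)
      * exp (- complex_of_real t - \<rho> / complex_of_real t)
      * hyp0F3 a (a / 2) ((a + 1) / 2) (B * (complex_of_real t)\<^sup>2 / 4)"
  shows "set_integrable lborel {0<..} f"
    and "(\<lambda>k. bessel_coeff a B k * gen_Gamma \<rho> (s + 2 * of_nat k)) sums (LBINT t:{0<..}. f t)"
proof -
  obtain C P where CP: "C \<ge> 0" "P > 0"
    and int: "\<And>k::nat. set_integrable lborel {0<..}
       (\<lambda>t. complex_of_real t powr (s + 2 * of_nat k - 1)
             * exp (- complex_of_real t - \<rho> / complex_of_real t))"
    and bound: "\<And>k::nat. (LBINT t:{0<..}. norm (complex_of_real t powr (s + 2 * of_nat k - 1)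
             * exp (- complex_of_real t - \<rho> / complex_of_real t))) \<le> C * Gamma (P + 2 * real k)"
    using gen_Gamma_integrand_bound[OF rho, of s] by blast
  define h where "h = (\<lambda>(k::nat) t. complex_of_real t powr (s + 2 * of_nat k - 1)
             * exp (- complex_of_real t - \<rho> / complex_of_real t))"
  define F where "F = (\<lambda>k t. indicator {0<..} t *\<^sub>R (bessel_coeff a B k * h k t))"
  have h_eq: "h k t = (complex_of_real t powr (s - 1) * exp (- complex_of_real t - \<rho> / complex_of_real t))
      * complex_of_real t ^ (2 * k)" if "t > 0" for k t
  proof -
    have "complex_of_real t powr (s + 2 * of_nat k - 1)
        = complex_of_real t powr (s - 1) * complex_of_real t powr of_nat (2 * k)"
      by (subst powr_add[symmetric]) (simp add: algebra_simps)
    also have "complex_of_real t powr of_nat (2 * k) = complex_of_real t ^ (2 * k)"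
      using that by (intro powr_complexpow) auto
    finally show ?thesis
      unfolding h_def by (simp only: mult_ac)
  qed
  have summ_pow: "summable (\<lambda>k. norm (bessel_coeff a B k) * t ^ (2 * k))" for t :: real
  proof (rule summable_bessel_coeff_weighted[OF a, of "t\<^sup>2" 1])
    fix k
    \<comment> \<open>The ratio \<open>t\<^sup>2\<close> is constant in \<open>k\<close>, so any quadratic that is at least \<open>1\<close> bounds it.\<close>
    have "1 * 1 \<le> (1 + 2 * real k) * (1 + 2 * real k + 1)"
      by (intro mult_mono) auto
    then have "t\<^sup>2 * 1 * t ^ (2 * k) \<le> t\<^sup>2 * ((1 + 2 * real k) * (1 + 2 * real k + 1)) * t ^ (2 * k)"
      by (intro mult_right_mono mult_left_mono) auto
    then show "t ^ (2 * Suc k) \<le> t\<^sup>2 * ((1 + 2 * real k) * (1 + 2 * real k + 1)) * t ^ (2 * k)"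
      by (simp add: power2_eq_square)
  qed auto
  have summ_Gamma: "summable (\<lambda>k. norm (bessel_coeff a B k) * (C * Gamma (P + 2 * real k)))"
  proof (rule summable_bessel_coeff_weighted[OF a, of 1 P])
    fix k :: nat
    have pos: "P + 2 * real k > 0"
      using CP(2) by simp
    show "C * Gamma (P + 2 * real k) \<ge> 0"
      using CP(1) Gamma_real_pos[OF pos] by simp
    have "Gamma (P + 2 * real k + 1 + 1)
        = (P + 2 * real k + 1) * ((P + 2 * real k) * Gamma (P + 2 * real k))"
      using pos by (subst Gamma_plus1, force elim!: nonpos_Ints_cases)+ auto
    then show "C * Gamma (P + 2 * real (Suc k))
        \<le> 1 * ((P + 2 * real k) * (P + 2 * real k + 1)) * (C * Gamma (P + 2 * real k))"
      by (simp add: algebra_simps)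
  qed (use CP in auto)
  have intF: "integrable lborel (F k)" for k
    using set_integrable_mult_right[OF int[of k], of "bessel_coeff a B k"]
    by (simp add: F_def h_def set_integrable_def)
  have normF: "norm (F k t) = norm (bessel_coeff a B k) * (indicator {0<..} t *\<^sub>R norm (h k t))" for k t
    by (simp add: F_def norm_mult)
  have summF: "AE t in lborel. summable (\<lambda>k. norm (F k t))"
  proof (intro AE_I2)
    fix t :: real
    let ?e = "complex_of_real t powr (s - 1) * exp (- complex_of_real t - \<rho> / complex_of_real t)"
    show "summable (\<lambda>k. norm (F k t))"
    proof (cases "t > 0")
      case True
      have "(\<lambda>k. norm (F k t)) = (\<lambda>k. norm ?e * (norm (bessel_coeff a B k) * t ^ (2 * k)))"
        using True by (simp add: normF h_eq norm_mult norm_power fun_eq_iff)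
      then show ?thesis
        using summable_mult[OF summ_pow] by simp
    qed (simp add: F_def)
  qed
  have sumsF: "summable (\<lambda>k. \<integral>t. norm (F k t) \<partial>lborel)"
  proof (rule summable_comparison_test'[OF summ_Gamma])
    fix k :: nat
    have "(\<integral>t. norm (F k t) \<partial>lborel) = norm (bessel_coeff a B k) * (LBINT t:{0<..}. norm (h k t))"
      unfolding normF set_lebesgue_integral_def by simp
    also have "\<dots> \<le> norm (bessel_coeff a B k) * (C * Gamma (P + 2 * real k))"
      using bound[of k] by (intro mult_left_mono) (auto simp: h_def)
    finally show "norm (\<integral>t. norm (F k t) \<partial>lborel) \<le> norm (bessel_coeff a B k) * (C * Gamma (P + 2 * real k))"
      by simp
  qed
  have suminfF: "(\<Sum>k. F k t) = indicator {0<..} t *\<^sub>R f t" for t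
  proof (cases "t > 0")
    case True
    let ?e = "complex_of_real t powr (s - 1) * exp (- complex_of_real t - \<rho> / complex_of_real t)"
    have "summable (\<lambda>k. norm (bessel_coeff a B k * complex_of_real t ^ (2 * k)))"
      using summ_pow[of t] True by (simp add: norm_mult norm_power)
    then have "summable (\<lambda>k. bessel_coeff a B k * complex_of_real t ^ (2 * k))"
      by (rule summable_norm_cancel)
    then have "?e * (\<Sum>k. bessel_coeff a B k * complex_of_real t ^ (2 * k))
        = (\<Sum>k. ?e * (bessel_coeff a B k * complex_of_real t ^ (2 * k)))"
      by (rule suminf_mult[symmetric])
    also have "\<dots> = (\<Sum>k. F k t)"
    proof (rule suminf_cong)
      show "?e * (bessel_coeff a B k * complex_of_real t ^ (2 * k)) = F k t" for k
        using True h_eq[OF True, of k] by (simp only: F_def indicator_simps greaterThan_iff scaleR_one mult_ac)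
    qed
    finally show ?thesis
      using True by (simp add: f_def hyp0F3_duplication)
  qed (simp add: F_def)
  show "set_integrable lborel {0<..} f"
    using integrable_suminf[OF intF summF sumsF] by (simp add: suminfF set_integrable_def)
  have "(\<integral>t. F k t \<partial>lborel) = bessel_coeff a B k * gen_Gamma \<rho> (s + 2 * of_nat k)" for k
  proof -
    have "(\<integral>t. F k t \<partial>lborel) = (LBINT t:{0<..}. bessel_coeff a B k * h k t)"
      by (simp only: F_def set_lebesgue_integral_def)
    then show ?thesis
      by (simp add: gen_Gamma_def h_def)
  qed
  then show "(\<lambda>k. bessel_coeff a B k * gen_Gamma \<rho> (s + 2 * of_nat k)) sums (LBINT t:{0<..}. f t)"
    using sums_integral[OF intF summF sumsF] by (simp add: suminfF set_lebesgue_integral_def)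
qed

text \<open>
  The source of both representations: the spherical function uses it at \<open>\<nu> + 1/2\<close> and
  \<open>c - 1/2\<close>, the Clifford function at the argument \<open>2 \<surd>z\<close>. The condition on \<open>\<nu>\<close> keeps
  \<open>\<nu> + 1\<close> off the poles of the Gamma function.
\<close>

lemma gen_Bessel_integral_representation:
  fixes b c \<nu> z \<rho> :: complex
  assumes rho: "Re \<rho> > 0" and nu: "Re \<nu> > -1" and z: "z \<noteq> 0"
  defines "f \<equiv> \<lambda>t::real. complex_of_real t powr (c + \<nu> - 1)
      * exp (- complex_of_real t - \<rho> / complex_of_real t)
      * hyp0F3 (\<nu> + 1) ((\<nu> + 1) / 2) ((\<nu> + 2) / 2) (- b * (z / 2)\<^sup>2 * (complex_of_real t)\<^sup>2 / 4)"
  shows "set_integrable lborel {0<..} f"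
    and "gen_Bessel b c \<nu> z \<rho> = (z / 2) powr \<nu> / ((Gamma (\<nu> + 1))\<^sup>2 * Gamma c) * (LBINT t:{0<..}. f t)"
proof -
  let ?B = "- b * (z / 2)\<^sup>2"
  have a: "Re (\<nu> + 1) > 0"
    using nu by simp
  have a2: "\<nu> + 2 = (\<nu> + 1) + 1"
    by simp
  note tr = hyp0F3_gen_Gamma_transform[OF rho a, where s = "c + \<nu>" and B = ?B]
  show "set_integrable lborel {0<..} f"
    using tr(1) unfolding f_def a2 .
  have npole: "\<nu> + 1 \<notin> \<int>\<^sub>\<le>\<^sub>0"
  proof
    assume "\<nu> + 1 \<in> \<int>\<^sub>\<le>\<^sub>0"
    then obtain n where n: "\<nu> + 1 = of_int n" "n \<le> 0"
      by (rule nonpos_Ints_cases)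
    have "Re (\<nu> + 1) = real_of_int n"
      unfolding n(1) by (rule complex_Re_of_int)
    then show False
      using n(2) a by linarith
  qed
  then have G0: "Gamma (\<nu> + 1) \<noteq> 0"
    by (simp add: Gamma_eq_zero_iff)
  have G: "Gamma (\<nu> + 1 + of_nat n) = Gamma (\<nu> + 1) * pochhammer (\<nu> + 1) n" for n
    using G0 by (simp add: pochhammer_Gamma[OF npole])
  have G1: "Gamma (\<nu> + of_nat k + 1) = Gamma (\<nu> + 1) * pochhammer (\<nu> + 1) k" for k
    using G[of k] by (simp add: add_ac)
  have G2: "Gamma (\<nu> + 2 * of_nat k + 1) = Gamma (\<nu> + 1) * pochhammer (\<nu> + 1) (2 * k)" for k
    using G[of "2 * k"] by (simp add: add_ac)
  have pw: "(z / 2) powr (2 * of_nat k + \<nu>) = ((z / 2)\<^sup>2) ^ k * (z / 2) powr \<nu>" for k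
  proof -
    have "(z / 2) powr (2 * of_nat k + \<nu>) = (z / 2) powr of_nat (2 * k) * (z / 2) powr \<nu>"
      by (simp add: powr_add)
    also have "(z / 2) powr of_nat (2 * k) = ((z / 2)\<^sup>2) ^ k"
      using z by (subst powr_complexpow) (auto simp: power_mult)
    finally show ?thesis .
  qed
  have "(- b) ^ k * gen_pochhammer c \<rho> (2 * of_nat k + \<nu>)
          / (Gamma (\<nu> + of_nat k + 1) * Gamma (\<nu> + 2 * of_nat k + 1))
          * ((z / 2) powr (2 * of_nat k + \<nu>) / fact k)
      = (z / 2) powr \<nu> / ((Gamma (\<nu> + 1))\<^sup>2 * Gamma c)
          * (bessel_coeff (\<nu> + 1) ?B k * gen_Gamma \<rho> (c + \<nu> + 2 * of_nat k))" for k
  proof -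
    have arg: "c + (2 * of_nat k + \<nu>) = c + \<nu> + 2 * of_nat k"
      by simp
    show ?thesis
      unfolding gen_pochhammer_def arg G1 G2 pw bessel_coeff_def power_mult_distrib[of "- b"]
      by (simp add: power2_eq_square mult_ac)
  qed
  then have "gen_Bessel b c \<nu> z \<rho> = (\<Sum>k. (z / 2) powr \<nu> / ((Gamma (\<nu> + 1))\<^sup>2 * Gamma c)
          * (bessel_coeff (\<nu> + 1) ?B k * gen_Gamma \<rho> (c + \<nu> + 2 * of_nat k)))"
    by (simp add: gen_Bessel_def)
  also have "\<dots> = (z / 2) powr \<nu> / ((Gamma (\<nu> + 1))\<^sup>2 * Gamma c) * (LBINT t:{0<..}. f t)"
    using sums_mult[OF tr(2)] unfolding f_def a2 by (rule sums_unique[symmetric])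
  finally show "gen_Bessel b c \<nu> z \<rho>
      = (z / 2) powr \<nu> / ((Gamma (\<nu> + 1))\<^sup>2 * Gamma c) * (LBINT t:{0<..}. f t)" .
qed


section \<open>Branches of the prefactors\<close>

text \<open>
  Writing \<open>\<pi> / (2z) = (\<pi> / 4) (z / 2)\<^bsup>-1\<^esup>\<close> gives \<open>(\<surd>\<pi> / 2) / \<surd>(z / 2)\<close> for the root: a positive
  factor always comes out of a principal root, and inversion commutes with it off the cut.
\<close>

lemma csqrt_spherical_prefactor:
  assumes z: "z \<notin> \<real>\<^sub>\<le>\<^sub>0"
  shows "csqrt (of_real pi / (2 * z)) * (z / 2) powr (\<nu> + 1 / 2)
    = complex_of_real (sqrt pi) * (z / 2) powr \<nu> / 2"
proof -
  have z2: "z / 2 \<notin> \<real>\<^sub>\<le>\<^sub>0"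
    using z by (auto simp: complex_nonpos_Reals_iff)
  have nz: "z / 2 \<noteq> 0"
    using z by auto
  have "of_real pi / (2 * z) = complex_of_real (pi / 4) * inverse (z / 2)"
    by (simp add: field_simps)
  also have "csqrt \<dots> = complex_of_real (sqrt (pi / 4)) * csqrt (inverse (z / 2))"
    unfolding csqrt_conv_powr
    by (subst powr_times_real_left) (auto simp: csqrt_conv_powr[symmetric] csqrt_of_real)
  also have "csqrt (inverse (z / 2)) = inverse (csqrt (z / 2))"
    by (rule csqrt_inverse[OF z2])
  finally have "csqrt (of_real pi / (2 * z)) = complex_of_real (sqrt pi) / 2 * inverse (csqrt (z / 2))"
    by (simp add: real_sqrt_divide)
  moreover have "(z / 2) powr (\<nu> + 1 / 2) = (z / 2) powr \<nu> * csqrt (z / 2)"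
    by (simp add: powr_add csqrt_conv_powr)
  moreover have "csqrt (z / 2) \<noteq> 0"
    using nz by (simp only: csqrt_eq_0 not_False_eq_True)
  ultimately show ?thesis
    by (simp add: field_simps)
qed

lemma csqrt_powr:
  assumes "z \<noteq> 0"
  shows "csqrt z powr \<nu> = z powr (\<nu> / 2)"
proof -
  have "Im (Ln z / 2) > - pi" "Im (Ln z / 2) \<le> pi"
    using mpi_less_Im_Ln[OF assms] Im_Ln_le_pi[OF assms] pi_gt_zero by auto
  then have "Ln (csqrt z) = Ln z / 2"
    using assms by (simp add: csqrt_exp_Ln Ln_exp)
  then have "exp (\<nu> * Ln (csqrt z)) = exp (\<nu> / 2 * Ln z)"
    by (simp only: times_divide_eq_left times_divide_eq_right)
  then show ?thesis
    using assms by (simp only: powr_def csqrt_eq_0 if_False)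
qed

theorem theorem6p3:
  fixes b \<rho> z :: complex
  assumes "Re \<rho> > 0" and "z \<notin> \<real>\<^sub>\<le>\<^sub>0"
  shows
    "(\<forall>\<nu> c :: complex. Re \<nu> > - 3/2 \<longrightarrow> Re c > 1/2 \<longrightarrow>
       (let f = (\<lambda>t::real. complex_of_real t powr (c + \<nu> - 1)
                  * exp (- complex_of_real t - \<rho> / complex_of_real t)
                  * hyp0F3 ((2 * \<nu> + 3) / 2) ((2 * \<nu> + 3) / 4) ((2 * \<nu> + 5) / 4)
                      (- b * z\<^sup>2 * (complex_of_real t)\<^sup>2 / 16))
        in set_integrable lborel {0<..} f \<and>
           gen_spherical_Bessel b c \<nu> z \<rho> =
             complex_of_real (sqrt pi) * (z / 2) powr \<nu>
               / (2 * (Gamma (\<nu> + 3/2))\<^sup>2 * Gamma (c - 1/2))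
             * (LBINT t:{0<..}. f t)))
     \<and>
     (\<forall>\<nu> l :: complex. Re \<nu> > - 1 \<longrightarrow> Re l > 0 \<longrightarrow>
       (let f = (\<lambda>t::real. complex_of_real t powr (l + \<nu> - 1)
                  * exp (- complex_of_real t - \<rho> / complex_of_real t)
                  * hyp0F3 (\<nu> + 1) ((\<nu> + 1) / 2) ((\<nu> + 2) / 2)
                      (- b * z * (complex_of_real t)\<^sup>2 / 4))
        in set_integrable lborel {0<..} f \<and>
           gen_Bessel_Clifford b l \<nu> z \<rho> =
             1 / ((Gamma (\<nu> + 1))\<^sup>2 * Gamma l) * (LBINT t:{0<..}. f t)))"
proof (intro conjI allI impI)
  fix \<nu> c :: complex
  assume nu: "Re \<nu> > - 3 / 2" and c: "Re c > 1 / 2"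
  have nz: "z \<noteq> 0"
    using assms(2) by auto
  have nu': "Re (\<nu> + 1 / 2) > - 1"
    using nu by simp
  note rep = gen_Bessel_integral_representation[OF assms(1) nu' nz, where c = "c - 1 / 2" and b = b]
  have params: "\<nu> + 1 / 2 + 1 = (2 * \<nu> + 3) / 2" "(2 * \<nu> + 3) / 2 / 2 = (2 * \<nu> + 3) / 4"
    "(\<nu> + 1 / 2 + 2) / 2 = (2 * \<nu> + 5) / 4" "c - 1 / 2 + (\<nu> + 1 / 2) = c + \<nu>"
    "(2 * \<nu> + 3) / 2 = \<nu> + 3 / 2"
    by (simp_all add: field_simps)
  have arg: "- b * (z / 2)\<^sup>2 * (complex_of_real t)\<^sup>2 / 4 = - b * z\<^sup>2 * (complex_of_real t)\<^sup>2 / 16" for t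
    by (simp add: power2_eq_square)
  note rep' = rep[unfolded arg params(1-4)]
  show "let f = (\<lambda>t::real. complex_of_real t powr (c + \<nu> - 1)
                  * exp (- complex_of_real t - \<rho> / complex_of_real t)
                  * hyp0F3 ((2 * \<nu> + 3) / 2) ((2 * \<nu> + 3) / 4) ((2 * \<nu> + 5) / 4)
                      (- b * z\<^sup>2 * (complex_of_real t)\<^sup>2 / 16))
        in set_integrable lborel {0<..} f \<and>
           gen_spherical_Bessel b c \<nu> z \<rho> =
             complex_of_real (sqrt pi) * (z / 2) powr \<nu>
               / (2 * (Gamma (\<nu> + 3/2))\<^sup>2 * Gamma (c - 1/2))
             * (LBINT t:{0<..}. f t)"
    unfolding Let_def gen_spherical_Bessel_def rep'(2) mult.assoc[symmetric]
      times_divide_eq_right csqrt_spherical_prefactor[OF assms(2)]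
    using rep'(1) unfolding params(5) by (simp add: mult_ac)
next
  fix \<nu> l :: complex
  assume nu: "Re \<nu> > - 1" and l: "Re l > 0"
  have nz: "z \<noteq> 0"
    using assms(2) by auto
  then have nz': "2 * csqrt z \<noteq> 0"
    by simp
  note rep = gen_Bessel_integral_representation[OF assms(1) nu nz', where c = l and b = b]
  have arg: "(2 * csqrt z / 2)\<^sup>2 = z"
    by simp
  have "z powr (- \<nu> / 2) * (2 * csqrt z / 2) powr \<nu> = 1"
    using nz by (simp add: csqrt_powr powr_add[symmetric])
  then show "let f = (\<lambda>t::real. complex_of_real t powr (l + \<nu> - 1)
                  * exp (- complex_of_real t - \<rho> / complex_of_real t)
                  * hyp0F3 (\<nu> + 1) ((\<nu> + 1) / 2) ((\<nu> + 2) / 2)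
                      (- b * z * (complex_of_real t)\<^sup>2 / 4))
        in set_integrable lborel {0<..} f \<and>
           gen_Bessel_Clifford b l \<nu> z \<rho> =
             1 / ((Gamma (\<nu> + 1))\<^sup>2 * Gamma l) * (LBINT t:{0<..}. f t)"
    using rep[unfolded arg] unfolding Let_def gen_Bessel_Clifford_def
    by (simp add: mult.assoc[symmetric])
qed

end
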